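(* There exists $n_0$ such that for all $n\ge n_0$, a red-blue $K_n$ contains at most \[\sum_{i\in[3]}\binom{n_i}{2}\binom{n-n_i}{2}=\frac{1}{27}n^4+O(n^3)\] copies of $H$, where $(n_1,n_2,n_3)$ is the unique vector of positive integers with $n_1+n_2+n_3=n$ and $n_1\ge n_2\ge n_3\ge n_1-1$. Moreover, this is achieved if and only if the red edges form the complete tripartite graph with parts of sizes $n_1,n_2,n_3$ (the Turán graph $T_3(n)$).
   Context: A red-blue $K_n$ is a complete graph on $n$ vertices each of whose edges is coloured red or blue. $H$ is the red-blue graph on four vertices $a,b,c,d$ consisting of a red $4$-cycle $abcd$ together with the blue chord $ac$ (so $H$ is $K_4$ minus an edge, with the $4$-cycle red and the remaining edge blue). A copy of $H$ in $G$ is a subgraph of $G$ isomorphic to $H$ by an isomorphism preserving edge colours. *)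

theory Defs
  imports Complex_Main "HOL-Library.Ramsey" "HOL-Library.Landau_Symbols"
begin

text \<open>Edges are two-element sets of vertices; \<open>nsets V 2\<close> is the edge set of the
  complete graph on \<open>V\<close>.\<close>

record 'a rb_graph =
  verts :: "'a set"
  red :: "'a set set"
  blue :: "'a set set"

definition rb_graph :: "'a rb_graph \<Rightarrow> bool" where
  "rb_graph G \<longleftrightarrow> finite (verts G) \<and> red G \<subseteq> nsets (verts G) 2 \<and>
     blue G \<subseteq> nsets (verts G) 2 \<and> red G \<inter> blue G = {}"

definition red_blue_K :: "nat \<Rightarrow> 'a rb_graph \<Rightarrow> bool" where
  "red_blue_K n G \<longleftrightarrow> rb_graph G \<and> card (verts G) = n \<and>
     red G \<union> blue G = nsets (verts G) 2"

definition rb_subgraph :: "'a rb_graph \<Rightarrow> 'a rb_graph \<Rightarrow> bool" where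
  "rb_subgraph K G \<longleftrightarrow> rb_graph K \<and> verts K \<subseteq> verts G \<and> red K \<subseteq> red G \<and> blue K \<subseteq> blue G"

definition rb_isomorphic :: "'a rb_graph \<Rightarrow> 'b rb_graph \<Rightarrow> bool" where
  "rb_isomorphic K L \<longleftrightarrow> (\<exists>f. bij_betw f (verts K) (verts L) \<and>
     red L = (\<lambda>e. f ` e) ` red K \<and> blue L = (\<lambda>e. f ` e) ` blue K)"

definition copies :: "'b rb_graph \<Rightarrow> 'a rb_graph \<Rightarrow> 'a rb_graph set" where
  "copies F G = {K. rb_subgraph K G \<and> rb_isomorphic F K}"

text \<open>The vertices \<open>a, b, c, d\<close> are \<open>0, 1, 2, 3\<close>.\<close>

definition H_graph :: "nat rb_graph" where
  "H_graph = \<lparr>verts = {0, 1, 2, 3},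
     red = {{0, 1}, {1, 2}, {2, 3}, {3, 0}}, blue = {{0, 2}}\<rparr>"

definition balanced_triple :: "nat \<Rightarrow> nat \<times> nat \<times> nat \<Rightarrow> bool" where
  "balanced_triple n = (\<lambda>(n1, n2, n3). 0 < n1 \<and> 0 < n2 \<and> 0 < n3 \<and>
     n1 + n2 + n3 = n \<and> n1 \<ge> n2 \<and> n2 \<ge> n3 \<and> int n3 \<ge> int n1 - 1)"

text \<open>A definite description: meaningful only when \<open>balanced_triple n\<close> has exactly one
  solution.\<close>

definition the_triple :: "nat \<Rightarrow> nat \<times> nat \<times> nat" where
  "the_triple n = (THE v. balanced_triple n v)"

definition H_bound :: "nat \<Rightarrow> nat" where
  "H_bound n = (case the_triple n of (n1, n2, n3) \<Rightarrow>
     (\<Sum>m\<leftarrow>[n1, n2, n3]. (m choose 2) * ((n - m) choose 2)))"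

definition complete_tripartite ::
  "'a set \<Rightarrow> 'a set set \<Rightarrow> nat \<times> nat \<times> nat \<Rightarrow> bool" where
  "complete_tripartite V E = (\<lambda>(n1, n2, n3). \<exists>A B C.
     V = A \<union> B \<union> C \<and> A \<inter> B = {} \<and> A \<inter> C = {} \<and> B \<inter> C = {} \<and>
     card A = n1 \<and> card B = n2 \<and> card C = n3 \<and>
     E = {{x, y} | x y. (x, y) \<in> A \<times> B \<union> A \<times> C \<union> B \<times> C})"

end

theory Submission
  imports Defs "HOL-Library.Disjoint_Sets"
begin

text \<open>A copy of \<open>H\<close> is a blue edge together with a pair of common red neighbours of its ends.
  In an extremal colouring every vertex lies in a copy, hence has red degree at least two: otherwise
  it could be replaced by a twin of a vertex that lies in a copy. If \<open>u\<close> and \<open>v\<close> are joined in blue,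
  then replacing \<open>v\<close> by a twin of \<open>u\<close> and replacing \<open>u\<close> by a twin of \<open>v\<close> change the number of copies
  by amounts whose sum is nonnegative, and positive unless \<open>u\<close> and \<open>v\<close> already have the same red
  neighbours. So the red graph of an extremal colouring is complete multipartite, and a part of size
  \<open>a\<close> contains the blue edges of \<open>(a choose 2) * (n - a choose 2)\<close> copies. This function of
  \<open>a \<ge> 1\<close> lies below its chord through \<open>q = n div 3\<close> and \<open>q + 1\<close>, whose constant term is nonpositive,
  so summing over at least three parts gives the bound; one or two parts are far from optimal.\<close>

section \<open>Optimising the part sizes\<close>

definition part_weight :: "nat \<Rightarrow> nat \<Rightarrow> nat" where
  "part_weight n a = (a choose 2) * ((n - a) choose 2)"

lemma real_choose_two: "real (m choose 2) = real m * (real m - 1) / 2"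
proof (cases m)
  case (Suc k)
  have "even (m * (m - 1))" by (cases m) auto
  then have "real (m * (m - 1) div 2) = real (m * (m - 1)) / real 2"
    by (rule real_of_nat_div)
  with Suc show ?thesis by (simp add: choose_two algebra_simps)
qed (simp add: choose_two)

text \<open>The factor 4 clears the two halves, so that the chord argument handles a polynomial with
  integer coefficients; \<open>a \<le> n\<close> turns the truncated subtraction
  \<open>n - a\<close> into the real one.\<close>

lemma real_part_weight:
  assumes "a \<le> n"
  shows "4 * real (part_weight n a) = real a * (real a - 1) * (real n - real a) * (real n - real a - 1)"
  using assms by (simp add: part_weight_def real_choose_two of_nat_diff)

section \<open>Balanced triples and the size of the bound\<close>

lemma div_3_cases:
  fixes n :: nat
  obtains (0) q where "n = 3 * q" "n div 3 = q" "(n + 1) div 3 = q" "(n + 2) div 3 = q"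
  | (1) q where "n = 3 * q + 1" "n div 3 = q" "(n + 1) div 3 = q" "(n + 2) div 3 = q + 1"
  | (2) q where "n = 3 * q + 2" "n div 3 = q" "(n + 1) div 3 = q + 1" "(n + 2) div 3 = q + 1"
proof -
  have "n = 3 * (n div 3) \<or> n = 3 * (n div 3) + 1 \<or> n = 3 * (n div 3) + 2"
    by linarith
  then show ?thesis
  proof (elim disjE)
    assume n: "n = 3 * (n div 3)"
    show ?thesis by (rule 0[of "n div 3"]) (use n in linarith)+
  next
    assume n: "n = 3 * (n div 3) + 1"
    show ?thesis by (rule 1[of "n div 3"]) (use n in linarith)+
  next
    assume n: "n = 3 * (n div 3) + 2"
    show ?thesis by (rule 2[of "n div 3"]) (use n in linarith)+
  qed
qed

text \<open>Three integers in weakly decreasing order whose extremes differ by at most one are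
  determined by their sum: each is a third of it, rounded up or down. With \<open>n \<ge> 3\<close>
  the smallest is positive.\<close>

lemma balanced_triple_iff:
  assumes "n \<ge> 3"
  shows "balanced_triple n v \<longleftrightarrow> v = ((n + 2) div 3, (n + 1) div 3, n div 3)"
proof (cases v)
  case (fields n1 n2 n3)
  have le: "int n3 \<ge> int n1 - 1 \<longleftrightarrow> n1 \<le> n3 + 1" by linarith
  show ?thesis
    using assms
    by (cases n rule: div_3_cases) (auto simp: fields balanced_triple_def le simp del: add_2_eq_Suc' Suc_eq_plus1)
qed

lemma the_triple_eq:
  assumes "n \<ge> 3"
  shows "the_triple n = ((n + 2) div 3, (n + 1) div 3, n div 3)"
  unfolding the_triple_def by (rule the_equality) (simp_all add: balanced_triple_iff assms)

lemma H_bound_eq: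
  assumes "n \<ge> 3"
  shows "H_bound n = part_weight n ((n + 2) div 3) + part_weight n ((n + 1) div 3) + part_weight n (n div 3)"
  by (simp add: H_bound_def the_triple_eq[OF assms] part_weight_def)

text \<open>With \<open>u = a * (n - a)\<close> the quartic becomes
  \<open>u * (u - (n - 1))\<close>. For \<open>a\<close> within 1 of \<open>n / 3\<close>,
  \<open>u\<close> is within \<open>n\<close> of \<open>c = 2 / 9 * n ^ 2\<close>, whose square is
  the main term.\<close>

lemma part_weight_near_third:
  fixes n a :: nat
  assumes "n \<ge> 3" "a \<le> n" "\<bar>real a - real n / 3\<bar> \<le> 1"
  shows "\<bar>4 * real (part_weight n a) - 4 / 81 * real n ^ 4\<bar> \<le> 4 * real n ^ 3"
proof -
  define N where "N = real n"
  define d where "d = real a - N / 3"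
  define u where "u = real a * (N - real a)"
  define c where "c = 2 / 9 * N ^ 2"
  have N: "N \<ge> 3" and d: "\<bar>d\<bar> \<le> 1"
    using assms by (auto simp: N_def d_def)
  have w: "4 * real (part_weight n a) - 4 / 81 * N ^ 4 = (u - c) * (u + c) - (N - 1) * u"
    unfolding real_part_weight[OF assms(2)] u_def c_def N_def
    by (simp add: algebra_simps power2_eq_square power4_eq_xxxx)
  have u0: "0 \<le> u" using assms by (simp add: u_def N_def)
  have u1: "u \<le> N ^ 2 / 4"
    using zero_le_power2[of "N - 2 * real a"] unfolding u_def
    by (simp add: power2_eq_square algebra_simps)
  have "u - c = d * (N / 3 - d)"
    unfolding u_def c_def d_def by (simp add: power2_eq_square field_simps)
  then have "\<bar>u - c\<bar> = \<bar>d\<bar> * \<bar>N / 3 - d\<bar>" by (simp add: abs_mult)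
  also have "\<dots> \<le> 1 * (N / 3 + 1)"
    by (rule mult_mono) (use d N in auto)
  finally have uc: "\<bar>u - c\<bar> \<le> N" using N by simp
  have "0 \<le> c" "c \<le> N ^ 2 / 4" by (simp_all add: c_def)
  then have "0 \<le> u + c" "u + c \<le> N ^ 2"
    using u0 u1 by linarith+
  then have 1: "\<bar>(u - c) * (u + c)\<bar> \<le> N * N ^ 2"
    unfolding abs_mult by (intro mult_mono) (use uc N in auto)
  have 2: "\<bar>(N - 1) * u\<bar> \<le> N * N ^ 2"
    unfolding abs_mult
  proof (rule mult_mono)
    show "\<bar>u\<bar> \<le> N ^ 2" using u0 u1 zero_le_power2[of N] by linarith
  qed (use N in auto)
  have N3: "N * N ^ 2 = N ^ 3" "0 \<le> N ^ 3" using N by (simp_all add: power3_eq_cube power2_eq_square)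
  have "\<bar>(u - c) * (u + c) - (N - 1) * u\<bar> \<le> 4 * N ^ 3"
    using 1 2 N3 by linarith
  then show ?thesis unfolding w[symmetric] by (simp add: N_def)
qed

lemma H_bound_asymptotics:
  "(\<lambda>n. real (H_bound n) - 1 / 27 * real n ^ 4) \<in> O(\<lambda>n. real n ^ 3)"
proof (rule bigoI)
  \<comment> \<open>Four times each weight misses \<open>4 / 81 * n ^ 4\<close> by at most
    \<open>4 * n ^ 3\<close>. Adding three of these and dividing by 4 gives the main term
    \<open>1 / 27 * n ^ 4\<close> and the constant 3.\<close>
  show "eventually (\<lambda>n. norm (real (H_bound n) - 1 / 27 * real n ^ 4) \<le> 3 * norm (real n ^ 3)) at_top"
    using eventually_ge_at_top[of 3]
  proof eventually_elim
    case (elim n)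
    have *: "\<bar>4 * real (part_weight n ((n + i) div 3)) - 4 / 81 * real n ^ 4\<bar> \<le> 4 * real n ^ 3"
      if "i \<le> 2" for i
    proof (rule part_weight_near_third[OF elim])
      have "3 * ((n + i) div 3) \<le> n + 2" "n \<le> 3 * ((n + i) div 3) + 2" using that by linarith+
      then have "3 * real ((n + i) div 3) \<le> real n + 2" "real n \<le> 3 * real ((n + i) div 3) + 2"
        by linarith+
      then show "\<bar>real ((n + i) div 3) - real n / 3\<bar> \<le> 1" by linarith
      show "(n + i) div 3 \<le> n" using that elim by linarith
    qed
    show ?case
      using *[of 0] *[of 1] *[of 2] unfolding H_bound_eq[OF elim] by (simp, argo)
  qed
qed

text \<open>Slope and constant term of the line through the points of the graph of \<open>4 * part_weight n\<close>
  at \<open>q\<close> and \<open>q + 1\<close>.\<close>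

definition chord_slope :: "real \<Rightarrow> real \<Rightarrow> real" where
  "chord_slope n q = q * (n - q - 1) * (2 * n - 4 * q - 2)"

definition chord_offset :: "real \<Rightarrow> real \<Rightarrow> real" where
  "chord_offset n q = - (n - 3 * q) * q * (q + 1) * (n - q - 1)"

text \<open>As a polynomial in \<open>a\<close> the difference vanishes at \<open>q\<close> and
  \<open>q + 1\<close>, so these linear factors split off. The quadratic cofactor is written as two
  summands that are separately nonnegative in the range of interest.\<close>

lemma chord_minus_part_weight:
  fixes n q a :: real
  shows "chord_slope n q * a + chord_offset n q - a * (a - 1) * (n - a) * (n - a - 1) =
    (a - q) * (a - q - 1) * ((a - 1) * (2 * n - 2 - 2 * q - a) + (n - q - 1) * (2 - (n - 3 * q)))"
  unfolding chord_slope_def chord_offset_def by (simp add: algebra_simps)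

text \<open>No integer lies strictly between \<open>q\<close> and \<open>q + 1\<close>, so the
  product of the linear factors is nonnegative; \<open>1 \<le> a \<le> n\<close> and
  \<open>n mod 3 \<le> 2\<close> do the same for the two summands of the cofactor. Its zeros add one
  stray contact point: singleton parts when \<open>n mod 3 = 2\<close>.\<close>

lemma chord_ge_part_weight:
  fixes n a :: nat
  defines "q \<equiv> n div 3"
  assumes n: "n \<ge> 9" and a: "1 \<le> a" "a \<le> n"
  shows "4 * real (part_weight n a) \<le> chord_slope n q * a + chord_offset n q"
    and "4 * real (part_weight n a) = chord_slope n q * a + chord_offset n q \<Longrightarrow>
      a = q \<or> a = q + 1 \<or> a = 1 \<and> n mod 3 = 2"
proof -
  define Q where "Q = (real a - 1) * (2 * real n - 2 - 2 * real q - real a) +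
    (real n - real q - 1) * (2 - (real n - 3 * real q))"
  have n_eq: "n = 3 * q + n mod 3" by (simp add: q_def)
  have r: "n mod 3 < 3" by simp
  have nr: "real n = 3 * real q + real (n mod 3)" using n_eq by linarith
  have q: "q \<ge> 3" using n by (simp add: q_def)
  have diff: "chord_slope n q * a + chord_offset n q - 4 * real (part_weight n a) =
      ((real a - q) * (real a - q - 1)) * Q"
    unfolding Q_def real_part_weight[OF a(2)] by (rule chord_minus_part_weight)
  have Q1: "0 \<le> (real a - 1) * (2 * real n - 2 - 2 * real q - real a)"
    by (rule mult_nonneg_nonneg) (use a q nr in linarith)+
  have Q2: "0 \<le> (real n - real q - 1) * (2 - (real n - 3 * real q))"
    by (rule mult_nonneg_nonneg) (use q nr r in linarith)+
  have F: "0 \<le> (real a - q) * (real a - q - 1)"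
  proof (cases "a \<le> q")
    case True then show ?thesis by (intro mult_nonpos_nonpos) linarith+
  next
    case False then show ?thesis by (intro mult_nonneg_nonneg) linarith+
  qed
  have "0 \<le> ((real a - q) * (real a - q - 1)) * Q"
    using F Q1 Q2 by (simp add: Q_def)
  then show "4 * real (part_weight n a) \<le> chord_slope n q * a + chord_offset n q"
    using diff by linarith
  assume "4 * real (part_weight n a) = chord_slope n q * a + chord_offset n q"
  then have "((real a - q) * (real a - q - 1)) * Q = 0" using diff by linarith
  then have "real a - q = 0 \<or> real a - q - 1 = 0 \<or> Q = 0" by simp
  then consider "real a = q" | "real a = q + 1" | "Q = 0" by linarith
  then show "a = q \<or> a = q + 1 \<or> a = 1 \<and> n mod 3 = 2"
  proof cases
    case 3
    then have z: "(real a - 1) * (2 * real n - 2 - 2 * real q - real a) = 0"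
      "(real n - real q - 1) * (2 - (real n - 3 * real q)) = 0"
      using Q1 Q2 unfolding Q_def by linarith+
    have "2 * real n - 2 - 2 * real q - real a > 0" "real n - real q - 1 > 0"
      using a q nr by linarith+
    then have "real a = 1" "real (n mod 3) = 2" using z nr by auto
    then show ?thesis by linarith
  qed linarith+
qed

text \<open>All three sizes are \<open>q\<close> or \<open>q + 1\<close>, where the chord is exact,
  and they add up to \<open>n\<close>.\<close>

lemma H_bound_chord:
  fixes n :: nat
  defines "q \<equiv> n div 3"
  assumes n: "n \<ge> 6"
  shows "4 * real (H_bound n) = chord_slope n q * n + 3 * chord_offset n q"
proof -
  have on: "4 * real (part_weight n b) = chord_slope n q * b + chord_offset n q"
    if "b = q \<or> b = q + 1" for b
  proof -
    have "b \<le> n" using that n by (auto simp: q_def)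
    moreover have "(real b - q) * (real b - q - 1) = 0" using that by auto
    ultimately show ?thesis
      using chord_minus_part_weight[of n q b] real_part_weight[of b n] by (metis eq_iff_diff_eq_0 mult_zero_left)
  qed
  have "(n + 2) div 3 + (n + 1) div 3 + n div 3 = n"
    by (cases n rule: div_3_cases) linarith+
  then have s: "real n = real ((n + 2) div 3) + real ((n + 1) div 3) + real q"
    unfolding q_def by linarith
  have "(n + 2) div 3 = q \<or> (n + 2) div 3 = q + 1" "(n + 1) div 3 = q \<or> (n + 1) div 3 = q + 1"
    unfolding q_def by linarith+
  from this[THEN on] on[of q] have
    "4 * real (H_bound n) = chord_slope n q * (real ((n + 2) div 3) + real ((n + 1) div 3) + real q) + 3 * chord_offset n q"
    using n by (simp add: H_bound_eq q_def distrib_left)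
  then show ?thesis using s by simp
qed

text \<open>Both weights are the same function of \<open>u = a * (n - a) \<le> n ^ 2 / 4\<close>.
  Eight times their sum is thus asymptotically at most \<open>n ^ 4 / 4\<close>, against
  \<open>8 / 27 * n ^ 4\<close> for the bound.\<close>

lemma two_parts_lt_H_bound:
  assumes n: "n \<ge> 100" and a: "a \<le> n"
  shows "part_weight n a + part_weight n (n - a) < H_bound n"
proof -
  define q where "q = n div 3"
  have nr: "real n = 3 * real q \<or> real n = 3 * real q + 1 \<or> real n = 3 * real q + 2"
    by (cases n rule: div_3_cases) (auto simp: q_def)
  have "q \<ge> 33" using n by (simp add: q_def)
  \<comment> \<open>33 is the least value of \<open>q\<close> for \<open>n \<ge> 100\<close>; after
    this shift the final inequality is settled, for each residue of \<open>n\<close>, by expanding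
    it in \<open>p \<ge> 0\<close>.\<close>
  define p where "p = real q - 33"
  have p: "p \<ge> 0" "real q = p + 33" using \<open>q \<ge> 33\<close> by (auto simp: p_def)
  define u where "u = real a * (real n - real a)"
  have u0: "0 \<le> u" using a by (simp add: u_def)
  have u1: "u \<le> real n ^ 2 / 4"
    using zero_le_power2[of "real n - 2 * real a"] unfolding u_def
    by (simp add: power2_eq_square algebra_simps)
  have "8 * real (part_weight n a + part_weight n (n - a)) = 4 * (u * (u - (real n - 1)))"
    using real_part_weight[OF a] real_part_weight[of "n - a" n] a
    by (simp add: of_nat_diff u_def algebra_simps)
  also have "\<dots> \<le> 4 * (real n ^ 2 / 4 * (real n ^ 2 / 4 - (real n - 1)))"
  proof -
    have "u * (u - (real n - 1)) \<le> u * (real n ^ 2 / 4 - (real n - 1))"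
      by (rule mult_left_mono) (use u0 u1 in auto)
    also have "\<dots> \<le> real n ^ 2 / 4 * (real n ^ 2 / 4 - (real n - 1))"
    proof (rule mult_right_mono[OF u1])
      have "0 \<le> (real n / 2 - 1) ^ 2" by simp
      then show "0 \<le> real n ^ 2 / 4 - (real n - 1)" by (simp add: power2_eq_square field_simps)
    qed
    finally show ?thesis by simp
  qed
  also have "\<dots> < 2 * (chord_slope n q * n + 3 * chord_offset n q)"
  proof -
    have "0 < 2 * (chord_slope n q * n + 3 * chord_offset n q) -
      4 * (real n ^ 2 / 4 * (real n ^ 2 / 4 - (real n - 1)))"
      using nr
      by (elim disjE; simp add: chord_slope_def chord_offset_def p(2))
        (simp_all add: algebra_simps power2_eq_square add_nonneg_pos p(1))
    then show ?thesis by simp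
  qed
  also have "\<dots> = 8 * real (H_bound n)"
    using H_bound_chord[of n] n by (simp add: q_def)
  finally show ?thesis by simp
qed

text \<open>For \<open>k \<ge> 3\<close> parts the chord inequalities add up to slope times
  \<open>n\<close> plus \<open>k\<close> times the offset. The offset is nonpositive, so
  \<open>k = 3\<close> is the largest case, and there the value is four times the bound. Fewer parts
  fall under \<open>two_parts_lt_H_bound\<close>.\<close>

lemma sum_part_weight_le:
  fixes s :: "'i \<Rightarrow> nat"
  assumes n: "n \<ge> 100" and I: "finite I" and pos: "\<And>i. i \<in> I \<Longrightarrow> s i \<ge> 1" and sum: "sum s I = n"
  shows "(\<Sum>i\<in>I. part_weight n (s i)) \<le> H_bound n"
    and "(\<Sum>i\<in>I. part_weight n (s i)) = H_bound n \<Longrightarrow>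
      card I = 3 \<and> (\<forall>i\<in>I. s i = n div 3 \<or> s i = n div 3 + 1)"
proof -
  define q where "q = n div 3"
  have q: "q \<ge> 33" "n = 3 * q + n mod 3" using n by (simp_all add: q_def)
  have le: "s i \<le> n" if "i \<in> I" for i
    using member_le_sum[of i I s] that I sum by simp
  have few: "(\<Sum>i\<in>I. part_weight n (s i)) < H_bound n" if k: "card I < 3"
  proof -
    have "card I \<noteq> 0" using I sum n by auto
    then consider "card I = 1" | "card I = 2" using k by linarith
    then show ?thesis
    proof cases
      \<comment> \<open>A single part counts as the split \<open>n + 0\<close>.\<close>
      case 1
      then obtain i where "I = {i}" by (auto simp: card_1_singleton_iff)
      then show ?thesis
        using sum two_parts_lt_H_bound[OF n, of n] by simp
    next
      case 2
      then obtain i j where ij: "I = {i, j}" "i \<noteq> j" by (auto simp: card_2_iff)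
      then have "s j = n - s i" "s i \<le> n" using sum by auto
      then show ?thesis using ij two_parts_lt_H_bound[OF n, of "s i"] by simp
    qed
  qed
  let ?al = "chord_slope n q" and ?be = "chord_offset n q"
  have pt: "4 * real (part_weight n (s i)) \<le> ?al * s i + ?be" if "i \<in> I" for i
    using chord_ge_part_weight(1)[of n "s i"] n pos[OF that] le[OF that] by (simp add: q_def)
  have lines: "(\<Sum>i\<in>I. ?al * s i + ?be) = ?al * n + card I * ?be"
  proof -
    have "(\<Sum>i\<in>I. real (s i)) = real n" unfolding sum[symmetric] by simp
    moreover have "(\<Sum>i\<in>I. ?al * s i + ?be) = ?al * (\<Sum>i\<in>I. real (s i)) + card I * ?be"
      by (simp add: sum.distrib sum_distrib_left)
    ultimately show ?thesis by simp
  qed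
  have tot: "4 * real (\<Sum>i\<in>I. part_weight n (s i)) = (\<Sum>i\<in>I. 4 * real (part_weight n (s i)))"
    by (simp add: sum_distrib_left)
  have be_eq: "?be = - real (n mod 3) * (real q * (real q + 1) * (real n - real q - 1))"
  proof -
    have "real (n mod 3) = real n - 3 * real q" using q(2) by linarith
    then show ?thesis by (simp add: chord_offset_def mult.assoc)
  qed
  have nq: "real q * (real q + 1) * (real n - real q - 1) > 0"
    by (intro mult_pos_pos) (use q in linarith)+
  have be: "?be \<le> 0" unfolding be_eq using nq by (simp add: mult_nonneg_nonneg)
  have Hb: "4 * real (H_bound n) = ?al * n + 3 * ?be"
    using H_bound_chord[of n] n by (simp add: q_def)
  have le1: "4 * real (\<Sum>i\<in>I. part_weight n (s i)) \<le> ?al * n + card I * ?be"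
    unfolding tot lines[symmetric] by (rule sum_mono) (rule pt)
  have le2: "card I * ?be \<le> 3 * ?be" if "card I \<ge> 3"
    using that be by (intro mult_right_mono_neg) auto
  show "(\<Sum>i\<in>I. part_weight n (s i)) \<le> H_bound n"
  proof (cases "card I < 3")
    case True with few show ?thesis by simp
  next
    case False with le1 le2 Hb show ?thesis by linarith
  qed
  assume eq: "(\<Sum>i\<in>I. part_weight n (s i)) = H_bound n"
  then have k: "card I \<ge> 3" using few by linarith
  then have eqk: "card I * ?be = 3 * ?be"
    and eqs: "(\<Sum>i\<in>I. 4 * real (part_weight n (s i))) = (\<Sum>i\<in>I. ?al * s i + ?be)"
    using le1 le2 Hb eq lines tot by linarith+
  have val: "s i = q \<or> s i = q + 1 \<or> s i = 1 \<and> n mod 3 = 2" if "i \<in> I" for i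
  proof -
    have "4 * real (part_weight n (s i)) = ?al * s i + ?be"
      using sum_mono_inv[OF eqs _ that I] pt by blast
    then show ?thesis
      using chord_ge_part_weight(2)[of n "s i"] n pos[OF that] le[OF that] by (simp add: q_def)
  qed
  \<comment> \<open>With four or more parts, equality forces the offset to vanish, so 3 divides
    \<open>n\<close>. This excludes the stray size 1, so every part has size at least
    \<open>q\<close>, and \<open>4 * q\<close> exceeds \<open>n = 3 * q\<close>.\<close>
  have k3: "card I = 3"
  proof (rule ccontr)
    assume "card I \<noteq> 3"
    then have "?be = 0" using eqk by simp
    then have "n mod 3 = 0" unfolding be_eq using nq by auto
    then have "q \<le> s i" if "i \<in> I" for i using val[OF that] by auto
    then have "card I * q \<le> n" using sum_bounded_below[of I q s] sum by simp
    moreover have "4 * q \<le> card I * q" using k \<open>card I \<noteq> 3\<close> by (intro mult_right_mono) auto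
    ultimately show False using \<open>n mod 3 = 0\<close> q by linarith
  qed
  then obtain i j l where ijl: "I = {i, j, l}" "i \<noteq> j" "j \<noteq> l" "i \<noteq> l"
    by (auto simp: card_3_iff)
  \<comment> \<open>Size 1 is excluded because the other two parts cover at most
    \<open>2 * (q + 1)\<close> vertices, leaving at least \<open>q - 2\<close> for the
    third.\<close>
  have "s i + s j + s l = n" using sum ijl by simp
  moreover have "s i \<le> q + 1" "s j \<le> q + 1" "s l \<le> q + 1"
    using val[of i] val[of j] val[of l] ijl q by auto
  ultimately have "s i > 1" "s j > 1" "s l > 1" using q by linarith+
  then show "card I = 3 \<and> (\<forall>i\<in>I. s i = n div 3 \<or> s i = n div 3 + 1)"
    using k3 val[of i] val[of j] val[of l] ijl by (auto simp: q_def)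
qed

section \<open>Symmetrisation\<close>

text \<open>A copy of \<open>H\<close> is encoded as the pair of its blue edge \<open>ac\<close> and the set \<open>{b, d}\<close>.\<close>

definition H_pairs :: "'a set \<Rightarrow> 'a set set \<Rightarrow> ('a set \<times> 'a set) set" where
  "H_pairs V E = {(e, p). e \<in> nsets V 2 \<and> e \<notin> E \<and> p \<in> nsets V 2 \<and> (\<forall>x\<in>e. \<forall>y\<in>p. {x, y} \<in> E)}"

lemma H_pairs_iff [simp]:
  "(e, p) \<in> H_pairs V E \<longleftrightarrow>
    e \<in> nsets V 2 \<and> e \<notin> E \<and> p \<in> nsets V 2 \<and> (\<forall>x\<in>e. \<forall>y\<in>p. {x, y} \<in> E)"
  by (simp add: H_pairs_def)

lemma finite_H_pairs: "finite V \<Longrightarrow> finite (H_pairs V E)"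
  by (rule finite_subset[of _ "nsets V 2 \<times> nsets V 2"])
    (auto simp: finite_imp_finite_nsets)

definition pair_graph :: "'a set \<times> 'a set \<Rightarrow> 'a rb_graph" where
  "pair_graph = (\<lambda>(e, p). \<lparr>verts = e \<union> p, red = {{x, y} | x y. x \<in> e \<and> y \<in> p}, blue = {e}\<rparr>)"

lemma singleton_not_in_nsets_2 [simp]: "{x} \<notin> nsets V 2"
  by (simp add: nsets_def)

text \<open>A common vertex \<open>x\<close> would make the loop \<open>{x, x}\<close> a red
  edge.\<close>

lemma H_pairs_disjoint:
  assumes "(e, p) \<in> H_pairs V E" "E \<subseteq> nsets V 2"
  shows "e \<inter> p = {}"
proof (rule ccontr)
  assume "e \<inter> p \<noteq> {}"
  then obtain x where "x \<in> e" "x \<in> p" by blast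
  then have "{x, x} \<in> nsets V 2" using assms by fastforce
  then show False by (simp del: doubleton_in_nsets_2)
qed

lemma H_graph_iso_pair_graph:
  assumes "a \<noteq> c" "b \<noteq> d" "{a, c} \<inter> {b, d} = {}"
  shows "rb_isomorphic H_graph (pair_graph ({a, c}, {b, d}))"
proof -
  define f :: "nat \<Rightarrow> 'a" where "f = (\<lambda>i. if i = 0 then a else if i = 1 then b else if i = 2 then c else d)"
  have f: "f 0 = a" "f (Suc 0) = b" "f 2 = c" "f 3 = d" by (simp_all add: f_def)
  have "bij_betw f {0, 1, 2, 3} {a, b, c, d}"
    using assms by (auto simp: bij_betw_def inj_on_def f)
  moreover have "{{x, y} | x y. x \<in> {a, c} \<and> y \<in> {b, d}} = {{a, b}, {b, c}, {c, d}, {d, a}}"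
    by (auto simp: insert_commute)
  moreover have "{a, b, c, d} = {a, c} \<union> {b, d}" by auto
  ultimately show ?thesis
    unfolding rb_isomorphic_def H_graph_def pair_graph_def
    by (intro exI[of _ f]) (simp add: f del: Un_insert_left Un_insert_right)
qed

text \<open>Copies are subgraphs that need not be induced, so the colour of \<open>bd\<close> is
  free. The blue chord and the opposite pair determine all four red edges.\<close>

lemma copies_H_graph:
  assumes G: "red_blue_K n G"
  shows "copies H_graph G = pair_graph ` H_pairs (verts G) (red G)"
proof -
  let ?V = "verts G" and ?E = "red G"
  from G have fin: "finite ?V" and sub: "?E \<subseteq> nsets ?V 2" and disj: "?E \<inter> blue G = {}"
    and un: "?E \<union> blue G = nsets ?V 2"
    by (auto simp: red_blue_K_def rb_graph_def)
  show ?thesis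
  proof (intro equalityI subsetI)
    fix K assume "K \<in> copies H_graph G"
    then obtain f where K: "rb_subgraph K G" and f: "bij_betw f {0, 1, 2, 3::nat} (verts K)"
      and r: "red K = {{f 0, f 1}, {f 1, f 2}, {f 2, f 3}, {f 3, f 0}}" and b: "blue K = {{f 0, f 2}}"
      by (auto simp: copies_def rb_isomorphic_def H_graph_def)
    have v: "verts K = {f 0, f 1, f 2, f 3}" and inj: "inj_on f {0, 1, 2, 3::nat}"
      using f by (auto simp: bij_betw_def)
    have ne: "f 0 \<noteq> f 2" "f 1 \<noteq> f 3"
      using inj by (simp_all add: inj_on_eq_iff)
    have "{{x, y} | x y. x \<in> {f 0, f 2} \<and> y \<in> {f 1, f 3}} = red K"
      unfolding r by (auto simp: insert_commute)
    then have "K = pair_graph ({f 0, f 2}, {f 1, f 3})"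
      using v b by (auto simp: pair_graph_def intro!: rb_graph.equality)
    moreover have "({f 0, f 2}, {f 1, f 3}) \<in> H_pairs ?V ?E"
      using K ne disj un by (auto simp: rb_subgraph_def r b v insert_commute)
    ultimately show "K \<in> pair_graph ` H_pairs ?V ?E" by blast
  next
    fix K assume "K \<in> pair_graph ` H_pairs ?V ?E"
    then obtain e p where K: "K = pair_graph (e, p)" and ep: "(e, p) \<in> H_pairs ?V ?E" by auto
    have ns: "e \<in> nsets ?V 2" "p \<in> nsets ?V 2" and eE: "e \<notin> ?E" using ep by auto
    then obtain a b c d where e: "e = {a, c}" "a \<noteq> c" and p: "p = {b, d}" "b \<noteq> d"
      by (meson nsets2_E)
    have ep0: "e \<inter> p = {}" by (rule H_pairs_disjoint[OF ep sub])
    have redK: "red K \<subseteq> ?E" using ep by (auto simp: K pair_graph_def)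
    have blueK: "blue K = {e}" and vertsK: "verts K = e \<union> p" by (simp_all add: K pair_graph_def)
    have "red K \<subseteq> nsets (verts K) 2" using ep0 by (auto simp: K pair_graph_def)
    moreover have "blue K \<subseteq> nsets (verts K) 2" using ns by (auto simp: nsets_def blueK vertsK)
    moreover have "finite (verts K)" using ns by (auto simp: vertsK nsets_def)
    moreover have "red K \<inter> blue K = {}" using redK eE by (auto simp: blueK)
    ultimately have "rb_graph K" by (simp add: rb_graph_def)
    moreover have "verts K \<subseteq> ?V" using ns by (auto simp: vertsK nsets_def)
    moreover have "blue K \<subseteq> blue G" using ns eE un by (auto simp: blueK)
    ultimately have "rb_subgraph K G" using redK by (simp add: rb_subgraph_def)
    then show "K \<in> copies H_graph G"
      using H_graph_iso_pair_graph[OF e(2) p(2)] ep0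
      by (simp add: copies_def K e(1) p(1))
  qed
qed

text \<open>A copy determines its pair: \<open>e\<close> is its only blue edge and \<open>p\<close>
  consists of the remaining vertices.\<close>

lemma card_copies_H_graph:
  assumes G: "red_blue_K n G"
  shows "card (copies H_graph G) = card (H_pairs (verts G) (red G))"
  unfolding copies_H_graph[OF G]
proof (rule card_image, rule inj_onI, clarify)
  fix e p e' p'
  assume 1: "(e, p) \<in> H_pairs (verts G) (red G)" "(e', p') \<in> H_pairs (verts G) (red G)"
    and eq: "pair_graph (e, p) = pair_graph (e', p')"
  have "red G \<subseteq> nsets (verts G) 2" using G by (simp add: red_blue_K_def rb_graph_def)
  note this [THEN H_pairs_disjoint[rotated]]
  then have "e \<inter> p = {}" "e' \<inter> p' = {}" using 1 by blast+
  moreover have "{e} = {e'}" "e \<union> p = e' \<union> p'"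
    using arg_cong[OF eq, of blue] arg_cong[OF eq, of verts] by (simp_all add: pair_graph_def)
  ultimately show "e = e' \<and> p = p'" by blast
qed

text \<open>Zykov symmetrisation: vertex \<open>v\<close> becomes a twin of \<open>u\<close>.\<close>

definition clone :: "'a set \<Rightarrow> 'a \<Rightarrow> 'a \<Rightarrow> 'a set set \<Rightarrow> 'a set set" where
  "clone V u v E = {e \<in> nsets V 2. id(v := u) ` e \<in> E}"

lemma clone_subset: "clone V u v E \<subseteq> nsets V 2"
  by (auto simp: clone_def)

text \<open>For the edge \<open>{u, v}\<close> the condition asks whether the singleton
  \<open>{u}\<close> is in \<open>E\<close>. As \<open>E\<close> will consist of two-element sets,
  the twins are then joined in blue.\<close>

lemma clone_iff:
  "{x, y} \<in> clone V u v E \<longleftrightarrow>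
    x \<in> V \<and> y \<in> V \<and> x \<noteq> y \<and> {if x = v then u else x, if y = v then u else y} \<in> E"
  by (auto simp: clone_def)

lemma clone_iff_avoid:
  assumes "v \<notin> e" "e \<in> nsets V 2"
  shows "e \<in> clone V u v E \<longleftrightarrow> e \<in> E"
proof -
  have "id(v := u) ` e = e" using assms(1) by (auto simp: image_iff)
  then show ?thesis using assms(2) by (simp add: clone_def)
qed

abbreviation on_pair :: "'a \<Rightarrow> 'a set \<times> 'a set \<Rightarrow> bool" where
  "on_pair x t \<equiv> x \<in> fst t \<union> snd t"

context
  fixes V :: "'a set" and E :: "'a set set" and u v :: 'a
  assumes fin: "finite V" and sub: "E \<subseteq> nsets V 2" and u: "u \<in> V" and v: "v \<in> V" and uv: "u \<noteq> v"
begin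

lemma singleton_not_edge: "{x} \<notin> E"
  using sub by auto

lemma H_pairs_clone_avoid:
  "{t \<in> H_pairs V (clone V u v E). \<not> on_pair v t} = {t \<in> H_pairs V E. \<not> on_pair v t}"
proof -
  have "(e, p) \<in> H_pairs V (clone V u v E) \<longleftrightarrow> (e, p) \<in> H_pairs V E" if "v \<notin> e \<union> p" for e p
  proof (cases "e \<in> nsets V 2 \<and> p \<in> nsets V 2")
    case True
    then have ep: "e \<subseteq> V" "p \<subseteq> V" by (auto simp: nsets_def)
    have "{x, y} \<in> clone V u v E \<longleftrightarrow> {x, y} \<in> E" if "x \<in> e" "y \<in> p" for x y
      using that \<open>v \<notin> e \<union> p\<close> ep singleton_not_edge by (auto simp: clone_iff)
    then show ?thesis using True that clone_iff_avoid[of v e V u E] by auto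
  qed auto
  then show ?thesis by (intro set_eqI) (auto simp del: H_pairs_iff)
qed

text \<open>Renaming \<open>u\<close> to \<open>v\<close> by \<open>r\<close> carries a copy through
  \<open>u\<close> only to one through the twin \<open>v\<close> only. Renaming back by
  \<open>s\<close> inverts this on sets avoiding \<open>v\<close>, and the same \<open>s\<close>
  decides membership in \<open>clone\<close>.\<close>

lemma card_H_pairs_clone_swap:
  "card {t \<in> H_pairs V E. on_pair u t \<and> \<not> on_pair v t} \<le>
   card {t \<in> H_pairs V (clone V u v E). on_pair v t \<and> \<not> on_pair u t}"
proof -
  define r where "r = id(u := v)"
  define s where "s = id(v := u)"
  have undo: "s ` r ` e = e" if "v \<notin> e" for e
    using that by (force simp: image_iff r_def s_def)
  let ?f = "\<lambda>(e, p). (r ` e, r ` p)"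
  have inj: "inj_on ?f {t \<in> H_pairs V E. on_pair u t \<and> \<not> on_pair v t}"
  proof (rule inj_on_inverseI[where g = "\<lambda>(e, p). (s ` e, s ` p)"])
    fix t assume "t \<in> {t \<in> H_pairs V E. on_pair u t \<and> \<not> on_pair v t}"
    then show "(\<lambda>(e, p). (s ` e, s ` p)) (?f t) = t"
      by (cases t) (simp add: undo)
  qed
  have fin': "finite {t \<in> H_pairs V (clone V u v E). on_pair v t \<and> \<not> on_pair u t}"
    using finite_H_pairs[OF fin] by simp
  have ns: "r ` e \<in> nsets V 2" if "e \<in> nsets V 2" "v \<notin> e" for e
  proof -
    have "inj_on r e" using that(2) by (auto simp: inj_on_def r_def)
    moreover have "r ` e \<subseteq> V" using that v by (auto simp: nsets_def r_def)
    ultimately show ?thesis using that by (simp add: nsets_def card_image)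
  qed
  have "?f ` {t \<in> H_pairs V E. on_pair u t \<and> \<not> on_pair v t}
    \<subseteq> {t \<in> H_pairs V (clone V u v E). on_pair v t \<and> \<not> on_pair u t}"
  proof (rule image_subsetI)
    fix t assume t: "t \<in> {t \<in> H_pairs V E. on_pair u t \<and> \<not> on_pair v t}"
    obtain e p where ep_eq: "t = (e, p)" by (cases t)
    have ep: "(e, p) \<in> H_pairs V E" and on: "on_pair u (e, p)" "\<not> on_pair v (e, p)"
      using t unfolding ep_eq by blast+
    have ve: "v \<notin> e" "v \<notin> p" using on by auto
    have e: "e \<in> nsets V 2" "p \<in> nsets V 2" "e \<notin> E" using ep by auto
    have "r ` e \<notin> clone V u v E" using undo[OF ve(1)] e by (simp add: clone_def flip: s_def)
    moreover have "{r x, r y} \<in> clone V u v E" if "x \<in> e" "y \<in> p" for x y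
    proof -
      have xy: "{x, y} \<in> E" "x \<noteq> v" "y \<noteq> v" using that ep ve by auto
      then have "{x, y} \<in> nsets V 2" "v \<notin> {x, y}" using sub by auto
      from ns[OF this] undo[OF this(2)] xy(1) show ?thesis by (simp add: clone_def flip: s_def)
    qed
    ultimately have "(r ` e, r ` p) \<in> H_pairs V (clone V u v E)"
      using ns[OF e(1) ve(1)] ns[OF e(2) ve(2)] by auto
    moreover have "on_pair v (r ` e, r ` p)" using on(1) by (auto simp: r_def)
    moreover have "\<not> on_pair u (r ` e, r ` p)" using uv ve by (auto simp: r_def)
    ultimately show "?f t \<in> {t \<in> H_pairs V (clone V u v E). on_pair v t \<and> \<not> on_pair u t}"
      unfolding ep_eq by (simp del: H_pairs_iff)
  qed
  from inj this fin' show ?thesis by (rule card_inj_on_le)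
qed

text \<open>Edges between \<open>e\<close> and \<open>p\<close> are red, so the nonadjacent
  \<open>u\<close> and \<open>v\<close> lie on the same side of the pair. Each red edge that the
  copy needs at \<open>v\<close> is then inherited from one that it already has at
  \<open>u\<close>.\<close>

lemma H_pairs_clone_both:
  assumes "{u, v} \<notin> E"
  shows "{t \<in> H_pairs V E. on_pair u t \<and> on_pair v t}
    \<subseteq> {t \<in> H_pairs V (clone V u v E). on_pair u t \<and> on_pair v t}"
proof clarify
  fix e p
  assume ep: "(e, p) \<in> H_pairs V E" and on: "on_pair u (e, p)" "on_pair v (e, p)"
  have both: "u \<in> e \<and> v \<in> e \<and> u \<notin> p \<and> v \<notin> p \<or> u \<in> p \<and> v \<in> p \<and> u \<notin> e \<and> v \<notin> e"
    using ep on assms H_pairs_disjoint[OF ep sub] by (auto simp: insert_commute)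
  have e: "e \<in> nsets V 2" "p \<in> nsets V 2" "e \<notin> E" using ep by auto
  then have sV: "e \<subseteq> V" "p \<subseteq> V" by (auto simp: nsets_def)
  have "e \<notin> clone V u v E"
  proof (cases "v \<in> e")
    case True
    with both e have "e = {u, v}" using uv by (auto elim!: nsets2_E)
    then show ?thesis using singleton_not_edge by (simp add: clone_iff)
  next
    case False then show ?thesis using clone_iff_avoid[of v e V u E] e by simp
  qed
  moreover have "{x, y} \<in> clone V u v E" if "x \<in> e" "y \<in> p" for x y
    using that ep both sV H_pairs_disjoint[OF ep sub] by (auto simp: clone_iff)
  ultimately show "(e, p) \<in> H_pairs V (clone V u v E) \<and> on_pair u (e, p) \<and> on_pair v (e, p)"
    using e on by auto
qed

lemma card_H_pairs_split:
  "card (H_pairs V F) = card {t \<in> H_pairs V F. \<not> on_pair v t}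
    + card {t \<in> H_pairs V F. on_pair v t \<and> \<not> on_pair u t}
    + card {t \<in> H_pairs V F. on_pair u t \<and> on_pair v t}"
proof -
  have f: "finite (H_pairs V F)" by (rule finite_H_pairs[OF fin])
  have "H_pairs V F = {t \<in> H_pairs V F. \<not> on_pair v t}
    \<union> ({t \<in> H_pairs V F. on_pair v t \<and> \<not> on_pair u t} \<union> {t \<in> H_pairs V F. on_pair u t \<and> on_pair v t})"
    by auto
  then have "card (H_pairs V F) = card \<dots>" by simp
  also have "\<dots> = card {t \<in> H_pairs V F. \<not> on_pair v t}
    + card ({t \<in> H_pairs V F. on_pair v t \<and> \<not> on_pair u t} \<union> {t \<in> H_pairs V F. on_pair u t \<and> on_pair v t})"
    by (rule card_Un_disjoint) (use f in auto)
  also have "card ({t \<in> H_pairs V F. on_pair v t \<and> \<not> on_pair u t} \<union> {t \<in> H_pairs V F. on_pair u t \<and> on_pair v t})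
    = card {t \<in> H_pairs V F. on_pair v t \<and> \<not> on_pair u t} + card {t \<in> H_pairs V F. on_pair u t \<and> on_pair v t}"
    by (rule card_Un_disjoint) (use f in auto)
  finally show ?thesis by simp
qed

text \<open>Cloning trades the copies through \<open>v\<close> only for at least as many as pass
  through \<open>u\<close> only. Copies through both are left uncompared, since the gain of the
  symmetrisation is found there.\<close>

lemma card_H_pairs_clone_ge:
  "card (H_pairs V (clone V u v E)) \<ge> card {t \<in> H_pairs V E. \<not> on_pair v t}
    + card {t \<in> H_pairs V E. on_pair u t \<and> \<not> on_pair v t}
    + card {t \<in> H_pairs V (clone V u v E). on_pair u t \<and> on_pair v t}"
  using card_H_pairs_split[of "clone V u v E"] card_H_pairs_clone_swap
  unfolding H_pairs_clone_avoid by linarith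

end

section \<open>Structure of extremal colourings\<close>

definition H_maximal :: "'a set \<Rightarrow> 'a set set \<Rightarrow> bool" where
  "H_maximal V E \<longleftrightarrow> E \<subseteq> nsets V 2 \<and> (\<forall>F \<subseteq> nsets V 2. card (H_pairs V F) \<le> card (H_pairs V E))"

lemma ex_H_maximal:
  assumes "finite V"
  shows "\<exists>E. H_maximal V E"
proof -
  have "finite (Pow (nsets V 2))" using assms by (simp add: finite_imp_finite_nsets)
  then have fin: "finite ((\<lambda>F. card (H_pairs V F)) ` Pow (nsets V 2))" by simp
  have "Max ((\<lambda>F. card (H_pairs V F)) ` Pow (nsets V 2)) \<in> (\<lambda>F. card (H_pairs V F)) ` Pow (nsets V 2)"
    by (rule Max_in[OF fin]) auto
  then obtain E where "E \<subseteq> nsets V 2"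
    "Max ((\<lambda>F. card (H_pairs V F)) ` Pow (nsets V 2)) = card (H_pairs V E)" by auto
  then show ?thesis using Max_ge[OF fin] by (auto simp: H_maximal_def)
qed

context
  fixes V :: "'a set" and E :: "'a set set"
  assumes fin: "finite V" and max: "H_maximal V E" and ne: "H_pairs V E \<noteq> {}"
begin

lemma H_maximal_subset: "E \<subseteq> nsets V 2"
  using max by (simp add: H_maximal_def)

lemma H_maximal_clone: "card (H_pairs V (clone V u v E)) \<le> card (H_pairs V E)"
  using max clone_subset[of V u v E] by (simp add: H_maximal_def)

text \<open>Turning an uncovered \<open>v\<close> into a twin of a vertex \<open>u\<close> of some
  copy destroys no copy and creates at least one.\<close>

lemma H_maximal_vertex_covered:
  assumes v: "v \<in> V"
  shows "\<exists>t \<in> H_pairs V E. on_pair v t"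
proof (rule ccontr)
  assume no: "\<not> ?thesis"
  from ne obtain e p where ep: "(e, p) \<in> H_pairs V E" by (auto simp del: H_pairs_iff)
  then obtain u where u: "u \<in> e" "u \<in> V" by (auto elim!: nsets2_E)
  have uv: "u \<noteq> v" using no ep u by (metis UnI1 fst_conv)
  have "{t \<in> H_pairs V E. \<not> on_pair v t} = H_pairs V E" using no by auto
  moreover have "(e, p) \<in> {t \<in> H_pairs V E. on_pair u t \<and> \<not> on_pair v t}"
    using ep no u by (fastforce simp del: H_pairs_iff)
  then have "card {t \<in> H_pairs V E. on_pair u t \<and> \<not> on_pair v t} > 0"
    using finite_H_pairs[OF fin] by (auto simp: card_gt_0_iff)
  ultimately show False
    using card_H_pairs_clone_ge[OF fin H_maximal_subset u(2) v uv] H_maximal_clone[of u v] by simp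
qed

text \<open>Every vertex of a copy has two red neighbours in it, and at most one of them is
  \<open>x\<close>.\<close>

lemma H_maximal_other_neighbour:
  assumes "v \<in> V"
  shows "\<exists>y. y \<noteq> x \<and> {v, y} \<in> E"
proof -
  obtain e p where ep: "(e, p) \<in> H_pairs V E" "v \<in> e \<or> v \<in> p"
    using H_maximal_vertex_covered[OF assms] by auto
  from ep(1) obtain a b c d where "e = {a, c}" "a \<noteq> c" "p = {b, d}" "b \<noteq> d"
    by (auto elim!: nsets2_E)
  then have "\<exists>y z. y \<noteq> z \<and> {v, y} \<in> E \<and> {v, z} \<in> E"
    using ep by (metis H_pairs_iff insertCI insertE insert_commute singletonD)
  then show ?thesis by metis
qed

text \<open>Maximality is applied to both directions of cloning. In the sum of the two inequalities
  all copies through at most one of \<open>u\<close> and \<open>v\<close> cancel, so the two cloned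
  counts of copies through both total at most twice the original one. Neither is smaller than the
  original, so both equal it.\<close>

lemma H_maximal_clone_both_eq:
  assumes u: "u \<in> V" and v: "v \<in> V" and uv: "u \<noteq> v" "{u, v} \<notin> E"
  shows "{t \<in> H_pairs V (clone V u v E). on_pair u t \<and> on_pair v t}
    = {t \<in> H_pairs V E. on_pair u t \<and> on_pair v t}"
proof -
  let ?B = "\<lambda>F. {t \<in> H_pairs V F. on_pair u t \<and> on_pair v t}"
  let ?u = "{t \<in> H_pairs V E. on_pair u t \<and> \<not> on_pair v t}"
  let ?v = "{t \<in> H_pairs V E. on_pair v t \<and> \<not> on_pair u t}"
  have B: "{t \<in> H_pairs V F. on_pair v t \<and> on_pair u t} = ?B F" for F by blast
  note ctx = fin H_maximal_subset
  have vu: "v \<noteq> u" "{v, u} \<notin> E" using uv by (auto simp: insert_commute)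
  have fB: "finite (?B F)" for F using finite_H_pairs[OF fin] by simp
  have sub1: "?B E \<subseteq> ?B (clone V u v E)"
    by (rule H_pairs_clone_both[OF ctx u v uv])
  have sub2: "?B E \<subseteq> ?B (clone V v u E)"
    using H_pairs_clone_both[OF ctx v u vu] unfolding B .
  have "card (?B E) \<le> card (?B (clone V v u E))"
    by (rule card_mono[OF fB sub2])
  moreover have "card (H_pairs V E) = card {t \<in> H_pairs V E. \<not> on_pair v t} + card ?v + card (?B E)"
    by (rule card_H_pairs_split[OF ctx u v uv(1)])
  moreover have "card (H_pairs V E) = card {t \<in> H_pairs V E. \<not> on_pair u t} + card ?u + card (?B E)"
    using card_H_pairs_split[OF ctx v u vu(1), of E] unfolding B .
  moreover have "card {t \<in> H_pairs V E. \<not> on_pair v t} + card ?u + card (?B (clone V u v E)) \<le> card (H_pairs V E)"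
    using card_H_pairs_clone_ge[OF ctx u v uv(1)] H_maximal_clone[of u v] by linarith
  moreover have "card {t \<in> H_pairs V E. \<not> on_pair u t} + card ?v + card (?B (clone V v u E)) \<le> card (H_pairs V E)"
    using card_H_pairs_clone_ge[OF ctx v u vu(1)] H_maximal_clone[of v u] unfolding B by linarith
  ultimately have "card (?B (clone V u v E)) \<le> card (?B E)" by linarith
  then show ?thesis using card_seteq[OF fB sub1] by simp
qed

lemma H_maximal_twins:
  assumes u: "u \<in> V" and v: "v \<in> V" and uv: "{u, v} \<notin> E" and x: "{u, x} \<in> E"
  shows "{v, x} \<in> E"
proof (cases "u = v")
  case False
  obtain y where y: "y \<noteq> x" "{u, y} \<in> E" using H_maximal_other_neighbour[OF u] by blast
  have V: "x \<in> V" "y \<in> V" "u \<noteq> x" "u \<noteq> y"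
    using x y(2) H_maximal_subset by (metis doubleton_in_nsets_2 subsetD)+
  have "x \<noteq> v" "y \<noteq> v" using x y uv by auto
  moreover have "{u} \<notin> E" using H_maximal_subset by auto
  \<comment> \<open>After cloning, \<open>x\<close> and \<open>y\<close> are common red neighbours
    of the twins. This copy contains both \<open>u\<close> and \<open>v\<close>, so it was present
    before, and there \<open>{v, x}\<close> is red.\<close>
  ultimately have "({u, v}, {x, y}) \<in> H_pairs V (clone V u v E)"
    using False u v V x y by (simp add: clone_iff)
  then have "({u, v}, {x, y}) \<in> {t \<in> H_pairs V (clone V u v E). on_pair u t \<and> on_pair v t}"
    by simp
  then have "({u, v}, {x, y}) \<in> H_pairs V E"
    unfolding H_maximal_clone_both_eq[OF u v False uv] by blast
  then show ?thesis by simp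
qed (use x in simp)

end

section \<open>Complete multipartite graphs\<close>

definition multipartite_edges :: "'a set \<Rightarrow> 'a set set \<Rightarrow> 'a set set" where
  "multipartite_edges V P = {e \<in> nsets V 2. \<not> (\<exists>A\<in>P. e \<subseteq> A)}"

text \<open>Non-adjacency in red is an equivalence relation, and its classes are the parts.
  Transitivity is the twin property: if \<open>x\<close> is nonadjacent to \<open>y\<close> but
  adjacent to \<open>z\<close>, then \<open>y\<close> is adjacent to \<open>z\<close>.\<close>

lemma H_maximal_multipartite:
  assumes fin: "finite V" and max: "H_maximal V E" and ne: "H_pairs V E \<noteq> {}"
  shows "\<exists>P. partition_on V P \<and> E = multipartite_edges V P"
proof -
  define r where "r = {(x, y). x \<in> V \<and> y \<in> V \<and> {x, y} \<notin> E}"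
  have sub: "E \<subseteq> nsets V 2" using max by (simp add: H_maximal_def)
  have "equiv V r"
  proof (rule equivI)
    show "r \<subseteq> V \<times> V" by (auto simp: r_def)
    show "refl_on V r" using sub by (auto simp: refl_on_def r_def nsets_def)
    show "sym r" by (auto simp: sym_def r_def insert_commute)
    show "trans r"
    proof (rule transI)
      fix x y z assume *: "(x, y) \<in> r" "(y, z) \<in> r"
      then show "(x, z) \<in> r"
        using H_maximal_twins[OF assms, of x y z] by (auto simp: r_def)
    qed
  qed
  moreover have "E = multipartite_edges V (V // r)"
  proof -
    have "{x, y} \<in> E \<longleftrightarrow> \<not> (\<exists>A\<in>V // r. {x, y} \<subseteq> A)" if "x \<in> V" "y \<in> V" for x y
    proof -
      have "(\<exists>A\<in>V // r. {x, y} \<subseteq> A) \<longleftrightarrow> (x, y) \<in> r"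
      proof
        assume "\<exists>A\<in>V // r. {x, y} \<subseteq> A"
        then show "(x, y) \<in> r" using quotient_eq_iff[OF \<open>equiv V r\<close>] by blast
      next
        assume "(x, y) \<in> r"
        then show "\<exists>A\<in>V // r. {x, y} \<subseteq> A"
          using equiv_class_self[OF \<open>equiv V r\<close>, of x] that
          by (intro bexI[of _ "r `` {x}"]) (auto intro: quotientI)
      qed
      then show ?thesis using that by (auto simp: r_def)
    qed
    then have "e \<in> E \<longleftrightarrow> e \<in> multipartite_edges V (V // r)" if "e \<in> nsets V 2" for e
      using that by (auto simp: multipartite_edges_def elim!: nsets2_E)
    then show ?thesis using sub by (auto simp: multipartite_edges_def)
  qed
  ultimately show ?thesis using partition_on_quotient by blast
qed

text \<open>A blue edge lies in exactly one part \<open>A\<close>, and the common red neighbours of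
  its ends are the vertices of \<open>V - A\<close>.\<close>

lemma card_H_pairs_multipartite:
  assumes fin: "finite V" and P: "partition_on V P"
  shows "card (H_pairs V (multipartite_edges V P)) =
    (\<Sum>A\<in>P. (card A choose 2) * ((card V - card A) choose 2))"
proof -
  have AV: "A \<subseteq> V" if "A \<in> P" for A using that P by (auto simp: partition_on_def)
  have same: "A = B" if "A \<in> P" "B \<in> P" "x \<in> A" "x \<in> B" for A B x
    using P that by (auto simp: partition_on_def disjoint_def)
  have "H_pairs V (multipartite_edges V P) = (\<Union>A\<in>P. nsets A 2 \<times> nsets (V - A) 2)"
  proof (intro equalityI subsetI; clarify)
    fix e p assume ep: "(e, p) \<in> H_pairs V (multipartite_edges V P)"
    then have e: "e \<in> nsets V 2" "e \<notin> multipartite_edges V P" and p: "p \<in> nsets V 2"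
      and adj: "\<And>x y. x \<in> e \<Longrightarrow> y \<in> p \<Longrightarrow> {x, y} \<in> multipartite_edges V P"
      by auto
    from e obtain A where A: "A \<in> P" "e \<subseteq> A" by (auto simp: multipartite_edges_def)
    have "e \<noteq> {}" using e by (auto simp: nsets_def)
    then obtain x where x: "x \<in> e" by blast
    have "y \<notin> A" if "y \<in> p" for y
      using adj[OF x that] x A by (auto simp: multipartite_edges_def)
    then show "(e, p) \<in> (\<Union>A\<in>P. nsets A 2 \<times> nsets (V - A) 2)"
      using A e p by (auto simp: nsets_def)
  next
    fix A e p assume A: "A \<in> P" and e: "e \<in> nsets A 2" and p: "p \<in> nsets (V - A) 2"
    have eA: "e \<subseteq> A" and pA: "p \<subseteq> V - A" using e p by (auto simp: nsets_def)
    have "e \<notin> multipartite_edges V P" using A eA by (auto simp: multipartite_edges_def)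
    moreover have "{x, y} \<in> multipartite_edges V P" if "x \<in> e" "y \<in> p" for x y
      using that eA pA A AV[OF A] same[OF A, of _ x] by (auto simp: multipartite_edges_def)
    moreover have "e \<in> nsets V 2" "p \<in> nsets V 2"
      using e p AV[OF A] by (auto simp: nsets_def)
    ultimately show "(e, p) \<in> H_pairs V (multipartite_edges V P)" by simp
  qed
  also have "card \<dots> = (\<Sum>A\<in>P. card (nsets A 2 \<times> nsets (V - A) 2))"
  proof (rule card_UN_disjoint)
    show "finite P" using fin P by (rule finite_elements)
    show "\<forall>A\<in>P. finite (nsets A 2 \<times> nsets (V - A) 2)"
      using fin AV by (auto intro!: finite_cartesian_product finite_imp_finite_nsets intro: finite_subset)
    show "\<forall>A\<in>P. \<forall>B\<in>P. A \<noteq> B \<longrightarrow> (nsets A 2 \<times> nsets (V - A) 2) \<inter> (nsets B 2 \<times> nsets (V - B) 2) = {}"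
    proof (intro ballI impI, rule ccontr)
      fix A B assume AB: "A \<in> P" "B \<in> P" "A \<noteq> B"
        "(nsets A 2 \<times> nsets (V - A) 2) \<inter> (nsets B 2 \<times> nsets (V - B) 2) \<noteq> {}"
      then obtain e where "e \<in> nsets A 2" "e \<in> nsets B 2" by blast
      then have "e \<subseteq> A" "e \<subseteq> B" "e \<noteq> {}" by (auto simp: nsets_def)
      then show False using same[OF AB(1,2)] AB(3) by blast
    qed
  qed
  also have "\<dots> = (\<Sum>A\<in>P. (card A choose 2) * ((card V - card A) choose 2))"
  proof (rule sum.cong[OF refl])
    fix A assume A: "A \<in> P"
    then have fA: "finite A" using AV fin finite_subset by blast
    have ns: "card (nsets X 2) = card X choose 2" if "finite X" for X :: "'a set"
    proof -
      have "nsets X 2 = {B. B \<subseteq> X \<and> card B = 2}"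
        using that finite_subset by (auto simp: nsets_def)
      then show ?thesis using n_subsets[OF that] by simp
    qed
    show "card (nsets A 2 \<times> nsets (V - A) 2) = (card A choose 2) * ((card V - card A) choose 2)"
      using fA fin AV[OF A] by (simp add: card_cartesian_product ns card_Diff_subset)
  qed
  finally show ?thesis .
qed

section \<open>Balanced tripartite graphs\<close>

lemma multipartite_edges_3:
  assumes V: "V = A \<union> B \<union> C" and dis: "A \<inter> B = {}" "A \<inter> C = {}" "B \<inter> C = {}"
  shows "multipartite_edges V {A, B, C} = {{x, y} | x y. (x, y) \<in> A \<times> B \<union> A \<times> C \<union> B \<times> C}"
proof -
  define D where "D = A \<times> B \<union> A \<times> C \<union> B \<times> C"
  have edge: "{x, y} \<in> multipartite_edges V {A, B, C} \<longleftrightarrow> (x, y) \<in> D \<or> (y, x) \<in> D" for x y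
    unfolding multipartite_edges_def V D_def using dis by auto
  have "multipartite_edges V {A, B, C} = {{x, y} | x y. (x, y) \<in> D}"
  proof (intro equalityI subsetI)
    fix e assume e: "e \<in> multipartite_edges V {A, B, C}"
    then have "e \<in> nsets V 2" by (simp add: multipartite_edges_def)
    then obtain x y where xy: "e = {x, y}" "e = {y, x}" by (auto elim!: nsets2_E)
    have "(x, y) \<in> D \<or> (y, x) \<in> D" using e xy(1) edge by simp
    then show "e \<in> {{x, y} | x y. (x, y) \<in> D}" using xy by blast
  next
    fix e assume "e \<in> {{x, y} | x y. (x, y) \<in> D}"
    then obtain x y where "e = {x, y}" "(x, y) \<in> D" by blast
    then show "e \<in> multipartite_edges V {A, B, C}" using edge by simp
  qed
  then show ?thesis by (simp only: D_def)
qed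

lemma complete_tripartite_partition:
  assumes P: "partition_on V {A, B, C}" and ne: "A \<noteq> B" "A \<noteq> C" "B \<noteq> C"
  shows "complete_tripartite V (multipartite_edges V {A, B, C}) (card A, card B, card C)"
proof -
  have V: "V = A \<union> B \<union> C" and dis: "A \<inter> B = {}" "A \<inter> C = {}" "B \<inter> C = {}"
    using P ne by (auto simp: partition_on_def disjoint_def)
  show ?thesis
    unfolding complete_tripartite_def prod.case
    by (intro exI[of _ A] exI[of _ B] exI[of _ C] conjI refl V dis multipartite_edges_3)
qed

text \<open>Positive sizes make the parts nonempty, as \<open>partition_on\<close> demands; being
  disjoint, they are then distinct, so \<open>{A, B, C}\<close> has three elements.\<close>

lemma complete_tripartiteD:
  assumes "complete_tripartite V E (a, b, c)" "a > 0" "b > 0" "c > 0"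
  obtains A B C where "partition_on V {A, B, C}" "A \<noteq> B" "A \<noteq> C" "B \<noteq> C"
    "card A = a" "card B = b" "card C = c" "E = multipartite_edges V {A, B, C}"
proof -
  from assms(1) obtain A B C where V: "V = A \<union> B \<union> C" and dis: "A \<inter> B = {}" "A \<inter> C = {}" "B \<inter> C = {}"
    and c: "card A = a" "card B = b" "card C = c"
    and E: "E = {{x, y} | x y. (x, y) \<in> A \<times> B \<union> A \<times> C \<union> B \<times> C}"
    unfolding complete_tripartite_def prod.case by (elim exE conjE) (rule that)
  have ne: "A \<noteq> {}" "B \<noteq> {}" "C \<noteq> {}" using c assms by auto
  have neq: "A \<noteq> B" "A \<noteq> C" "B \<noteq> C" using ne dis by auto
  have "partition_on V {A, B, C}"
    using ne dis by (auto simp: partition_on_def disjoint_def V)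
  moreover have "E = multipartite_edges V {A, B, C}"
    unfolding E by (rule multipartite_edges_3[OF V dis, symmetric])
  ultimately show thesis using that neq c by blast
qed

lemma card_H_pairs_partition:
  assumes "finite V" "card V = n" "partition_on V P"
  shows "card (H_pairs V (multipartite_edges V P)) = (\<Sum>A\<in>P. part_weight n (card A))"
  using card_H_pairs_multipartite[OF assms(1,3)] by (simp add: part_weight_def assms(2))

lemma card_H_pairs_tripartite:
  assumes fin: "finite V" and n: "card V = n" "n \<ge> 3" and E: "complete_tripartite V E (the_triple n)"
  shows "card (H_pairs V E) = H_bound n"
proof -
  have pos: "(n + 2) div 3 > 0" "(n + 1) div 3 > 0" "n div 3 > 0" using n by auto
  obtain A B C where P: "partition_on V {A, B, C}" and ne: "A \<noteq> B" "A \<noteq> C" "B \<noteq> C"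
    and c: "card A = (n + 2) div 3" "card B = (n + 1) div 3" "card C = n div 3"
    and E: "E = multipartite_edges V {A, B, C}"
    by (rule complete_tripartiteD[OF E[unfolded the_triple_eq[OF n(2)]] pos])
  show ?thesis
    unfolding E card_H_pairs_partition[OF fin n(1) P] H_bound_eq[OF n(2)] c[symmetric]
    using ne by simp
qed

lemma ex_balanced_tripartite:
  assumes fin: "finite V" and n: "card V = n" "n \<ge> 3"
  shows "\<exists>E \<subseteq> nsets V 2. complete_tripartite V E (the_triple n)"
proof -
  have sum: "(n + 2) div 3 + (n + 1) div 3 + n div 3 = n"
    by (cases n rule: div_3_cases) linarith+
  obtain A where A: "A \<subseteq> V" "card A = (n + 2) div 3"
    using obtain_subset_with_card_n[of "(n + 2) div 3" V] sum n by (metis le_add1 add.assoc)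
  have cVA: "card (V - A) = (n + 1) div 3 + n div 3"
    using A fin n sum by (simp add: card_Diff_subset finite_subset)
  obtain B where B: "B \<subseteq> V - A" "card B = (n + 1) div 3"
    using obtain_subset_with_card_n[of "(n + 1) div 3" "V - A"] cVA by (metis le_add1)
  define C where "C = V - A - B"
  have C: "card C = n div 3"
    using B cVA fin by (simp add: C_def card_Diff_subset finite_subset)
  let ?E = "{{x, y} | x y. (x, y) \<in> A \<times> B \<union> A \<times> C \<union> B \<times> C}"
  have "V = A \<union> B \<union> C" "A \<inter> B = {}" "A \<inter> C = {}" "B \<inter> C = {}"
    using A B by (auto simp: C_def)
  then have "complete_tripartite V ?E (the_triple n)"
    unfolding the_triple_eq[OF n(2)] complete_tripartite_def prod.case
    using A(2) B(2) C by blast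
  moreover have "?E \<subseteq> nsets V 2" using A B by (auto simp: C_def)
  ultimately show ?thesis by blast
qed

lemma complete_tripartite_the_triple:
  assumes fin: "finite V" and n: "card V = n" "n \<ge> 3" and P: "partition_on V P" and P3: "card P = 3"
    and sizes: "\<forall>A\<in>P. card A = n div 3 \<or> card A = n div 3 + 1"
  shows "complete_tripartite V (multipartite_edges V P) (the_triple n)"
proof -
  have finP: "finite A" if "A \<in> P" for A
    using fin P that by (auto simp: partition_on_def intro: finite_subset)
  have ordered: ?thesis
    if "P = {A, B, C}" "A \<noteq> B" "A \<noteq> C" "B \<noteq> C" "card A \<ge> card B" "card B \<ge> card C" for A B C
  proof -
    have "card V = card A + card B + card C"
      using product_partition[OF P finP] that(1-4) by simp
    then have "balanced_triple n (card A, card B, card C)"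
      using that sizes n by (auto simp: balanced_triple_def)
    then have "the_triple n = (card A, card B, card C)"
      using balanced_triple_iff[OF n(2)] the_triple_eq[OF n(2)] by simp
    then show ?thesis
      using complete_tripartite_partition[of V A B C] P that(1-4) by simp
  qed
  obtain A B C where ABC: "P = {A, B, C}" "A \<noteq> B" "B \<noteq> C" "A \<noteq> C"
    using P3 by (auto simp: card_3_iff)
  \<comment> \<open>The triple lists sizes in decreasing order, so the parts must be named
    accordingly; these are the six possible orders.\<close>
  consider "card A \<ge> card B" "card B \<ge> card C" | "card A \<ge> card C" "card C \<ge> card B"
    | "card B \<ge> card A" "card A \<ge> card C" | "card B \<ge> card C" "card C \<ge> card A"
    | "card C \<ge> card A" "card A \<ge> card B" | "card C \<ge> card B" "card B \<ge> card A"
    by linarith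
  then show ?thesis
    using ABC ordered[of A B C] ordered[of A C B] ordered[of B A C] ordered[of B C A]
      ordered[of C A B] ordered[of C B A]
    by cases (simp_all add: insert_commute)
qed

lemma H_maximal_tripartite:
  assumes fin: "finite V" and n: "card V = n" "n \<ge> 100" and max: "H_maximal V E"
  shows "card (H_pairs V E) = H_bound n \<and> complete_tripartite V E (the_triple n)"
proof -
  obtain F where F: "F \<subseteq> nsets V 2" "complete_tripartite V F (the_triple n)"
    using ex_balanced_tripartite[OF fin n(1)] n(2) by auto
  have "card (H_pairs V F) = H_bound n"
    using card_H_pairs_tripartite[OF fin n(1) _ F(2)] n(2) by simp
  then have ge: "H_bound n \<le> card (H_pairs V E)"
    using max F(1) unfolding H_maximal_def by metis
  \<comment> \<open>Being strictly above the count of the split \<open>0 + n\<close> already makes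
    the bound positive, so an extremal colouring contains a copy and the structure theorem
    applies.\<close>
  moreover have "H_bound n > 0" using two_parts_lt_H_bound[OF n(2), of 0] by simp
  ultimately have "H_pairs V E \<noteq> {}" by auto
  then obtain P where P: "partition_on V P" and E: "E = multipartite_edges V P"
    using H_maximal_multipartite[OF fin max] by blast
  have cE: "card (H_pairs V E) = (\<Sum>A\<in>P. part_weight n (card A))"
    unfolding E by (rule card_H_pairs_partition[OF fin n(1) P])
  have AV: "finite A" "card A \<ge> 1" if "A \<in> P" for A
  proof -
    have "A \<subseteq> V" "A \<noteq> {}" using P that by (auto simp: partition_on_def)
    then show "finite A" using fin finite_subset by blast
    then show "card A \<ge> 1" using \<open>A \<noteq> {}\<close> by (simp add: Suc_le_eq card_gt_0_iff)
  qed
  have finP: "finite P" using fin P by (rule finite_elements)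
  have sum: "(\<Sum>A\<in>P. card A) = n"
    using product_partition[OF P AV(1)] n(1) by simp
  have eq: "card (H_pairs V E) = H_bound n"
    using sum_part_weight_le(1)[OF n(2) finP AV(2) sum] cE ge by simp
  then have "card P = 3 \<and> (\<forall>A\<in>P. card A = n div 3 \<or> card A = n div 3 + 1)"
    using sum_part_weight_le(2)[OF n(2) finP AV(2) sum] cE by simp
  then have "complete_tripartite V E (the_triple n)"
    unfolding E using complete_tripartite_the_triple[OF fin n(1) _ P] n(2) by simp
  with eq show ?thesis by simp
qed

text \<open>A maximal colouring attains exactly the bound, so any colouring attaining it is itself
  maximal and has the extremal structure.\<close>

lemma card_H_pairs_le_H_bound:
  assumes fin: "finite V" and n: "card V = n" "n \<ge> 100" and E: "E \<subseteq> nsets V 2"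
  shows "card (H_pairs V E) \<le> H_bound n"
    and "card (H_pairs V E) = H_bound n \<longleftrightarrow> complete_tripartite V E (the_triple n)"
proof -
  obtain M where M: "H_maximal V M" using ex_H_maximal[OF fin] by blast
  have cM: "card (H_pairs V M) = H_bound n" using H_maximal_tripartite[OF fin n M] by simp
  show "card (H_pairs V E) \<le> H_bound n"
    using M E unfolding H_maximal_def cM by blast
  show "card (H_pairs V E) = H_bound n \<longleftrightarrow> complete_tripartite V E (the_triple n)"
  proof
    assume "card (H_pairs V E) = H_bound n"
    then have "H_maximal V E" using M E unfolding H_maximal_def cM by simp
    then show "complete_tripartite V E (the_triple n)" using H_maximal_tripartite[OF fin n] by blast
  next
    assume "complete_tripartite V E (the_triple n)"
    then show "card (H_pairs V E) = H_bound n"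
      using card_H_pairs_tripartite[OF fin n(1)] n(2) by simp
  qed
qed

theorem theorem8p1:
  "\<exists>n0::nat.
     (\<forall>n\<ge>n0. \<exists>!v. balanced_triple n v) \<and>
     (\<lambda>n. real (H_bound n) - 1 / 27 * real n ^ 4) \<in> O(\<lambda>n. real n ^ 3) \<and>
     (\<forall>n\<ge>n0. \<forall>G :: 'a rb_graph. red_blue_K n G \<longrightarrow>
        card (copies H_graph G) \<le> H_bound n \<and>
        (card (copies H_graph G) = H_bound n \<longleftrightarrow>
           complete_tripartite (verts G) (red G) (the_triple n)))"
proof (intro exI[of _ 100] conjI allI impI)
  \<comment> \<open>The threshold 100 is the one assumed in \<open>two_parts_lt_H_bound\<close> and
    carried along by the results built on it.\<close>
  fix n :: nat assume "100 \<le> n"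
  then show "\<exists>!v. balanced_triple n v" by (simp add: balanced_triple_iff)
next
  show "(\<lambda>n. real (H_bound n) - 1 / 27 * real n ^ 4) \<in> O(\<lambda>n. real n ^ 3)"
    by (rule H_bound_asymptotics)
next
  fix n :: nat and G :: "'a rb_graph"
  assume n: "100 \<le> n" and G: "red_blue_K n G"
  then have V: "finite (verts G)" "card (verts G) = n" "red G \<subseteq> nsets (verts G) 2"
    by (auto simp: red_blue_K_def rb_graph_def)
  show "card (copies H_graph G) \<le> H_bound n"
    "card (copies H_graph G) = H_bound n \<longleftrightarrow> complete_tripartite (verts G) (red G) (the_triple n)"
    unfolding card_copies_H_graph[OF G] using card_H_pairs_le_H_bound[OF V(1,2) n V(3)] by blast+
qed

end
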